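(* Let $G:\mathcal{U}\to\mathcal{Y}$ be an $(x_0,u_0)$-realization of the state-space model $\dot{x}(t)=f(x(t),u(t))$, $y(t)=g(x(t),u(t))$. The operator $G$ has uniform $w$-FM for all inputs of the form $T_{-t}(u_0\diamond u)$, with $u\in\mathcal{U}^+$ and $t\ge0$, if and only if the state-space model has $w$-FM for $\mathcal{X}_0=\{x_0\}$.
   Context: State-space model: $x(t)\in\mathbb{R}^{n_x}$ is the state, $u\in\mathcal{U}^+\subset L_\infty([0,+\infty),\mathbb{R}^{n_u})$ the input, $y(t)\in\mathbb{R}^{n_y}$ the output, $\mathcal{X}_0\subseteq\mathbb{R}^{n_x}$ the set of initial conditions; the system is forward complete (for every initial condition $x(0)\in\mathcal{X}_0$ and input $u\in\mathcal{U}^+$ the state trajectory is uniquely defined on $[0,+\infty)$) and $g$ is smooth in both arguments. Comparison functions: $\alpha:[0,+\infty)\to[0,+\infty)$ is of class $\mathcal{K}$ if it is continuous, strictly increasing and $\alpha(0)=0$; of class $\mathcal{K}_\infty$ if moreover $\lim_{r\to\infty}\alpha(r)=+\infty$. $\beta:[0,+\infty)^2\to[0,+\infty)$ is of class $\mathcal{KL}$ if it is continuous, $\beta(\cdot,s)\in\mathcal{K}$ for each $s$, and for each $r$, $\beta(r,\cdot)$ is nonincreasing with limit $0$ at $+\infty$. Memory kernel: a continuous nonincreasing function $w:[0,+\infty)\to[0,1]$ with $\lim_{\Delta t\to+\infty}w(\Delta t)=0$. Throughout, $w$ is a memory kernel, the same on both sides of the equivalence. State-space $w$-FM for $\mathcal{X}_0$: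 there exist $\beta\in\mathcal{KL}$ and $\gamma\in\mathcal{K}_\infty$ such that for any $x_a(0),x_b(0)\in\mathcal{X}_0$ and any $u_a,u_b\in\mathcal{U}^+$, the corresponding outputs satisfy for all $t\ge0$: $\|y_a(t)-y_b(t)\|\le\beta(\|x_a(0)-x_b(0)\|,t)+\gamma(\operatorname{ess\,sup}_{s\in[0,t]}w(t-s)\|u_a(s)-u_b(s)\|)$. Operators: $\mathcal{U}\subset L_\infty(\mathbb{R},\mathbb{R}^{n_u})$, $\mathcal{Y}\subset L_\infty(\mathbb{R},\mathbb{R}^{n_y})$ (outputs are evaluated pointwise). $u^-$ and $u^+$ denote the restrictions of $u$ to negative time $(-\infty,0]$ and positive time $[0,+\infty)$; $\mathcal{U}^-=\{u^-:u\in\mathcal{U}\}$, $\mathcal{U}^+=\{u^+:u\in\mathcal{U}\}$. $T_\tau f(t)=f(t-\tau)$. $G$ is time-invariant if $T_\tau u\in\mathcal{U}$ and $G(T_\tau u)=T_\tau G(u)$ for all $u\in\mathcal{U}$, $\tau\in\mathbb{R}$. $G$ is causal if for all $u_a,u_b\in\mathcal{U}$ and $t_0\in\mathbb{R}$: $u_a(t)=u_b(t)\ \forall t\le t_0$ implies $G(u_a)(t)=G(u_b)(t)\ \forall t\le t_0$. The memory functional $F_G:\mathcal{U}^-\to\mathbb{R}^{n_y}$ of a causal $G$ is the map with $F_G(u^-)=G(u)(0)$ for all $u\in\mathcal{U}$ (well defined by causality). For $u_0\in\mathcal{U}^-$, $u\in\mathcal{U}^+$, $u_0\diamond u$ is the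 temporal concatenation (equal to $u_0$ in negative time and to $u$ in positive time). Uniform $w$-FM of a causal and time-invariant operator $G$ for all inputs in a set $\mathcal{S}\subseteq\mathcal{U}$: there exists $\gamma\in\mathcal{K}_\infty$ such that for all $v_a,v_b\in\mathcal{S}$, $\|F_G(v_a^-)-F_G(v_b^-)\|\le\gamma\big(\operatorname{ess\,sup}_{s\le0}w(-s)\|v_a(s)-v_b(s)\|\big)$. In the claim, $\mathcal{S}=\{T_{-t}(u_0\diamond u):u\in\mathcal{U}^+,\ t\ge0\}$. $(x_0,u_0)$-realization: a causal and time-invariant operator $G:\mathcal{U}\to\mathcal{Y}$ such that the negative-time input $u_0\in\mathcal{U}^-$ satisfies: $u_0\diamond u\in\mathcal{U}$ for all $u\in\mathcal{U}^+$, and the output $y$ of the state-space model with initial condition $x(0)=x_0$ and input $u\in\mathcal{U}^+$ satisfies $y(t)=G(u_0\diamond u)(t)$ for all $t\ge0$.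
   Formalization: Uniform w-FM is required only between inputs T_{-t}(u_0⋄u_a) and T_{-t}(u_0⋄u_b) with the same t, with one gain γ for all t≥0; comparing inputs with different shifts t, as the definition literally says, makes the "if" direction false. *)

theory Defs
  imports "HOL-Probability.Essential_Supremum"
begin

section \<open>Comparison functions and memory kernels\<close>

text \<open>Functions on \<open>[0,\<infinity>)\<close> are total functions on \<^typ>\<open>real\<close> of which only the values on
  \<open>{0..}\<close> are constrained. Nonnegativity of comparison functions follows from the clauses given.\<close>

definition class_K :: "(real \<Rightarrow> real) \<Rightarrow> bool" where
  "class_K \<alpha> \<longleftrightarrow> continuous_on {0..} \<alpha> \<and> strict_mono_on {0..} \<alpha> \<and> \<alpha> 0 = 0"

definition class_K_inf :: "(real \<Rightarrow> real) \<Rightarrow> bool" where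
  "class_K_inf \<alpha> \<longleftrightarrow> class_K \<alpha> \<and> filterlim \<alpha> at_top at_top"

definition class_KL :: "(real \<Rightarrow> real \<Rightarrow> real) \<Rightarrow> bool" where
  "class_KL \<beta> \<longleftrightarrow>
     continuous_on ({0..} \<times> {0..}) (\<lambda>(r, s). \<beta> r s) \<and>
     (\<forall>s\<ge>0. class_K (\<lambda>r. \<beta> r s)) \<and>
     (\<forall>r\<ge>0. antimono_on {0..} (\<beta> r) \<and> (\<beta> r \<longlongrightarrow> 0) at_top)"

definition memory_kernel :: "(real \<Rightarrow> real) \<Rightarrow> bool" where
  "memory_kernel w \<longleftrightarrow>
     continuous_on {0..} w \<and> antimono_on {0..} w \<and> w ` {0..} \<subseteq> {0..1} \<and> (w \<longlongrightarrow> 0) at_top"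


section \<open>Signals\<close>

text \<open>Signals are functions, not equivalence classes modulo null sets, because outputs and
  causality refer to values at single times.\<close>

definition L_inf :: "real set \<Rightarrow> (real \<Rightarrow> 'a::euclidean_space) set" where
  "L_inf A = {u. u \<in> borel_measurable (lebesgue_on A) \<and>
                 (\<exists>C. AE t in lebesgue_on A. norm (u t) \<le> C)}"

text \<open>The essential supremum is taken in \<^typ>\<open>ennreal\<close>, so that over a null set, such as
  \<open>{0..t}\<close> with \<open>t = 0\<close>, it is \<open>0\<close>. It is finite for memory kernels and signals in \<open>L_inf\<close>.\<close>

definition ess_sup_on :: "real set \<Rightarrow> (real \<Rightarrow> real) \<Rightarrow> real" where
  "ess_sup_on A h = enn2real (esssup (lebesgue_on A) (\<lambda>s. ennreal (h s)))"

definition neg_part :: "(real \<Rightarrow> 'a) \<Rightarrow> real \<Rightarrow> 'a" where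
  "neg_part u = restrict u {..0}"

definition pos_part :: "(real \<Rightarrow> 'a) \<Rightarrow> real \<Rightarrow> 'a" where
  "pos_part u = restrict u {0..}"

text \<open>At time \<open>0\<close>, where both arguments are defined, the concatenation takes the value of the
  second one: this is the value on which \<open>y(0) = g(x(0), u(0))\<close> depends.\<close>

definition concat_at_0 :: "(real \<Rightarrow> 'a) \<Rightarrow> (real \<Rightarrow> 'a) \<Rightarrow> real \<Rightarrow> 'a" (infixr "\<diamondop>" 65) where
  "(u0 \<diamondop> u) t = (if t < 0 then u0 t else u t)"

definition shift :: "real \<Rightarrow> (real \<Rightarrow> 'a) \<Rightarrow> real \<Rightarrow> 'a" where
  "shift \<tau> u t = u (t - \<tau>)"


section \<open>State-space models\<close>

primrec C_k :: "nat \<Rightarrow> ('a::euclidean_space \<Rightarrow> 'b::euclidean_space) \<Rightarrow> bool" where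
  "C_k 0 h \<longleftrightarrow> continuous_on UNIV h"
| "C_k (Suc k) h \<longleftrightarrow>
     (\<forall>z. h differentiable at z) \<and> (\<forall>v. C_k k (\<lambda>z. frechet_derivative h (at z) v))"

definition smooth :: "('a::euclidean_space \<Rightarrow> 'b::euclidean_space) \<Rightarrow> bool" where
  "smooth h \<longleftrightarrow> (\<forall>k. C_k k h)"

text \<open>Inputs are only essentially bounded, so trajectories are Caratheodory solutions on
  \<open>[0,\<infinity>)\<close>: locally absolutely continuous functions that satisfy the differential equation almost
  everywhere, written as solutions of the integral equation.\<close>

definition state_trajectory ::
  "('x::euclidean_space \<Rightarrow> 'u \<Rightarrow> 'x) \<Rightarrow> 'x \<Rightarrow> (real \<Rightarrow> 'u) \<Rightarrow> (real \<Rightarrow> 'x) \<Rightarrow> bool" where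
  "state_trajectory f x0 u x \<longleftrightarrow>
     (\<forall>t\<ge>0. (\<lambda>s. f (x s) (u s)) absolutely_integrable_on {0..t} \<and>
            x t = x0 + integral {0..t} (\<lambda>s. f (x s) (u s)))"

definition forward_complete ::
  "('x::euclidean_space \<Rightarrow> 'u \<Rightarrow> 'x) \<Rightarrow> 'x set \<Rightarrow> (real \<Rightarrow> 'u) set \<Rightarrow> bool" where
  "forward_complete f X0 Up \<longleftrightarrow>
     (\<forall>x0\<in>X0. \<forall>u\<in>Up. \<exists>!x. x \<in> extensional {0..} \<and> state_trajectory f x0 u x)"

definition state_space_FM ::
  "(real \<Rightarrow> real) \<Rightarrow> ('x::euclidean_space \<Rightarrow> 'u::euclidean_space \<Rightarrow> 'x) \<Rightarrow>
   ('x \<Rightarrow> 'u \<Rightarrow> 'y::euclidean_space) \<Rightarrow> (real \<Rightarrow> 'u) set \<Rightarrow> 'x set \<Rightarrow> bool" where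
  "state_space_FM w f g Up X0 \<longleftrightarrow>
     (\<exists>\<beta> \<gamma>. class_KL \<beta> \<and> class_K_inf \<gamma> \<and>
       (\<forall>xa0\<in>X0. \<forall>xb0\<in>X0. \<forall>ua\<in>Up. \<forall>ub\<in>Up. \<forall>xa xb.
          state_trajectory f xa0 ua xa \<longrightarrow> state_trajectory f xb0 ub xb \<longrightarrow>
          (\<forall>t\<ge>0. norm (g (xa t) (ua t) - g (xb t) (ub t))
             \<le> \<beta> (norm (xa0 - xb0)) t
               + \<gamma> (ess_sup_on {0..t} (\<lambda>s. w (t - s) * norm (ua s - ub s))))))"


section \<open>Operators\<close>

definition time_invariant ::
  "(real \<Rightarrow> 'u) set \<Rightarrow> ((real \<Rightarrow> 'u) \<Rightarrow> real \<Rightarrow> 'y) \<Rightarrow> bool" where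
  "time_invariant U G \<longleftrightarrow>
     (\<forall>u\<in>U. \<forall>\<tau>. shift \<tau> u \<in> U \<and> G (shift \<tau> u) = shift \<tau> (G u))"

definition causal ::
  "(real \<Rightarrow> 'u) set \<Rightarrow> ((real \<Rightarrow> 'u) \<Rightarrow> real \<Rightarrow> 'y) \<Rightarrow> bool" where
  "causal U G \<longleftrightarrow>
     (\<forall>ua\<in>U. \<forall>ub\<in>U. \<forall>t0. (\<forall>t\<le>t0. ua t = ub t) \<longrightarrow> (\<forall>t\<le>t0. G ua t = G ub t))"

definition memory_functional ::
  "(real \<Rightarrow> 'u) set \<Rightarrow> ((real \<Rightarrow> 'u) \<Rightarrow> real \<Rightarrow> 'y) \<Rightarrow> (real \<Rightarrow> 'u) \<Rightarrow> 'y" where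
  "memory_functional U G p = (THE y. \<exists>u\<in>U. neg_part u = p \<and> y = G u 0)"

lemma memory_functional_neg_part:
  assumes "causal U G" "u \<in> U"
  shows "memory_functional U G (neg_part u) = G u 0"
proof -
  have *: "G v 0 = G u 0" if v: "v \<in> U" "neg_part v = neg_part u" for v
  proof -
    have "\<forall>t\<le>0. v t = u t"
    proof (intro allI impI)
      fix t :: real assume "t \<le> 0"
      then show "v t = u t"
        using fun_cong[OF v(2), of t] by (simp add: neg_part_def)
    qed
    moreover have "(\<forall>t\<le>0. v t = u t) \<longrightarrow> (\<forall>t\<le>0. G v t = G u t)"
      by (rule spec[OF bspec[OF bspec[OF assms(1)[unfolded causal_def] v(1)] assms(2)]])
    ultimately show ?thesis by simp
  qed
  show ?thesis
    unfolding memory_functional_def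
  proof (rule the_equality)
    show "\<exists>v\<in>U. neg_part v = neg_part u \<and> G u 0 = G v 0"
      using assms(2) by (intro bexI[of _ u] conjI refl)
    show "y = G u 0" if "\<exists>v\<in>U. neg_part v = neg_part u \<and> y = G v 0" for y
      using that by (elim bexE conjE) (simp add: *)
  qed
qed

text \<open>Uniform fading memory on each set of a family, with one gain for the whole family. For a
  single set \<open>S\<close> take the family \<open>{S}\<close>. The property on the union of a family implies the property
  on the family, but in general not conversely: inputs from different members are not compared.\<close>

definition uniform_FM ::
  "(real \<Rightarrow> real) \<Rightarrow> (real \<Rightarrow> 'u::euclidean_space) set \<Rightarrow>
   ((real \<Rightarrow> 'u) \<Rightarrow> real \<Rightarrow> 'y::euclidean_space) \<Rightarrow> (real \<Rightarrow> 'u) set set \<Rightarrow> bool" where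
  "uniform_FM w U G \<S> \<longleftrightarrow>
     (\<exists>\<gamma>. class_K_inf \<gamma> \<and>
       (\<forall>S\<in>\<S>. \<forall>va\<in>S. \<forall>vb\<in>S.
          norm (memory_functional U G (neg_part va) - memory_functional U G (neg_part vb))
            \<le> \<gamma> (ess_sup_on {..0} (\<lambda>s. w (- s) * norm (va s - vb s)))))"

lemma uniform_FM_Union: "uniform_FM w U G {\<Union>\<S>} \<Longrightarrow> uniform_FM w U G \<S>"
  unfolding uniform_FM_def by (elim exE, rule exI) auto

definition realization ::
  "('x::euclidean_space \<Rightarrow> 'u::euclidean_space \<Rightarrow> 'x) \<Rightarrow> ('x \<Rightarrow> 'u \<Rightarrow> 'y::euclidean_space) \<Rightarrow>
   (real \<Rightarrow> 'u) set \<Rightarrow> (real \<Rightarrow> 'y) set \<Rightarrow> 'x \<Rightarrow> (real \<Rightarrow> 'u) \<Rightarrow>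
   ((real \<Rightarrow> 'u) \<Rightarrow> real \<Rightarrow> 'y) \<Rightarrow> bool" where
  "realization f g U Y x0 u0 G \<longleftrightarrow>
     G ` U \<subseteq> Y \<and> causal U G \<and> time_invariant U G \<and> u0 \<in> neg_part ` U \<and>
     (\<forall>u \<in> pos_part ` U. u0 \<diamondop> u \<in> U \<and>
        (\<forall>x. state_trajectory f x0 u x \<longrightarrow> (\<forall>t\<ge>0. g (x t) (u t) = G (u0 \<diamondop> u) t)))"

text \<open>The inputs \<open>T\<^sub>-\<^sub>t (u\<^sub>0 \<diamondop> u)\<close> observed at time \<open>t\<close>. Comparing inputs with
  different \<open>t\<close> would be too strong to be equivalent to fading memory of a state-space model,
  which compares outputs at equal times: let \<open>x' = 1\<close>, \<open>y = sin x\<close>, \<open>x(0) = 0\<close>, let \<open>U\<close> be the set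
  of all measurable \<open>[0,1]\<close>-valued inputs, \<open>u\<^sub>0(s) = exp s\<close>, and \<open>G u t = sin (t - c)\<close> if \<open>u\<close>
  agrees with \<open>T\<^sub>c exp\<close> near minus infinity, \<open>G u t = 0\<close> if there is no such \<open>c\<close>. All outputs with
  \<open>x(0) = 0\<close> coincide, but \<open>u = 0\<close> shifted by \<open>t\<^sub>a \<noteq> t\<^sub>b\<close> gives values \<open>sin t\<^sub>a\<close>, \<open>sin t\<^sub>b\<close>
  that do not approach each other although the weighted input distance tends to \<open>0\<close> as
  \<open>t\<^sub>a, t\<^sub>b\<close> grow.\<close>

definition shifted_inputs ::
  "(real \<Rightarrow> 'u) set \<Rightarrow> (real \<Rightarrow> 'u) \<Rightarrow> real \<Rightarrow> (real \<Rightarrow> 'u) set" where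
  "shifted_inputs U u0 t = {shift (- t) (u0 \<diamondop> u) | u. u \<in> pos_part ` U}"

end

theory Submission
  imports Defs
begin

text \<open>Observing \<open>T\<^sub>-\<^sub>t (u\<^sub>0 \<diamondop> u)\<close> through the memory functional returns the
  output \<open>y(t)\<close>. Two such inputs with the same \<open>t\<close> agree before time \<open>-t\<close>, so their weighted
  distance over the past is the weighted distance of the positive-time inputs over \<open>[0,t]\<close>. Since
  \<open>\<X>\<^sub>0\<close> is a singleton, only \<open>\<beta>(0,t) = 0\<close> occurs and any function of class \<open>KL\<close> will do.\<close>

text \<open>The exceptional set of \<open>P\<close> is the translate by \<open>a\<close> of the
  exceptional set of \<open>\<lambda>x. P (x + a)\<close>, and a set is negligible exactly when its
  translates are.\<close>

lemma AE_lebesgue_translation_iff: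
  fixes a :: "'a::euclidean_space"
  shows "(AE x in lebesgue. P (x + a)) \<longleftrightarrow> (AE x in lebesgue. P x)"
proof -
  have AE_iff: "(AE x in lebesgue. Q x) \<longleftrightarrow> negligible {x. \<not> Q x}" for Q :: "'a \<Rightarrow> bool"
    by (simp add: completion.AE_iff_null_sets negligible_iff_null_sets)
  have "(+) a ` {x. \<not> P (x + a)} = {x. \<not> P x}"
  proof (intro equalityI subsetI)
    fix x assume "x \<in> {x. \<not> P x}"
    then show "x \<in> (+) a ` {x. \<not> P (x + a)}"
      by (intro image_eqI[where x = "x - a"]) auto
  qed (auto simp: add.commute)
  then show ?thesis
    unfolding AE_iff by (metis negligible_translation_rev negligible_translation)
qed

text \<open>For a measurable function \<open>esssup\<close> is the infimum of the almost-everywhere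
  upper bounds, so it depends on the measure space only through the set of these bounds. Without
  measurability \<open>esssup\<close> takes a default value.\<close>

lemma esssup_eqI:
  assumes "f \<in> borel_measurable M" "g \<in> borel_measurable N"
    and "\<And>z. (AE x in M. f x \<le> z) \<longleftrightarrow> (AE x in N. g x \<le> z)"
  shows "esssup M f = esssup N g"
  using assms by (simp add: esssup_eq_AE)

text \<open>Both essential suprema have the same upper bounds: translation by \<open>t\<close>
  carries \<open>{- t..0}\<close> onto \<open>{0..t}\<close>, and the earlier past, where
  \<open>h\<close> vanishes, imposes no constraint. For \<open>t = 0\<close> both sides are
  \<open>0\<close>.\<close>

lemma ess_sup_on_past_eq:
  assumes h: "h \<in> borel_measurable (lebesgue_on {..0})"
    and k: "k \<in> borel_measurable (lebesgue_on {0..t})"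
    and eq: "\<And>s. 0 \<le> s \<Longrightarrow> s \<le> t \<Longrightarrow> k s = h (s - t)"
    and zero: "\<And>s. s < - t \<Longrightarrow> h s = 0"
    and "0 \<le> t"
  shows "ess_sup_on {..0} h = ess_sup_on {0..t} k"
proof -
  have "(AE s in lebesgue_on {..0}. ennreal (h s) \<le> z) \<longleftrightarrow>
        (AE s in lebesgue_on {0..t}. ennreal (k s) \<le> z)" for z
  proof -
    have "(AE s in lebesgue_on {..0}. ennreal (h s) \<le> z) \<longleftrightarrow>
          (AE s in lebesgue. s \<le> 0 \<longrightarrow> ennreal (h s) \<le> z)"
      by (subst AE_restrict_space_iff) auto
    also have "\<dots> \<longleftrightarrow> (AE s in lebesgue. s + (- t) \<le> 0 \<longrightarrow> ennreal (h (s + (- t))) \<le> z)"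
      by (rule AE_lebesgue_translation_iff[symmetric])
    also have "\<dots> \<longleftrightarrow> (AE s in lebesgue. s \<in> {0..t} \<longrightarrow> ennreal (k s) \<le> z)"
    proof (rule arg_cong[where f = "\<lambda>Q. AE s in lebesgue. Q s"], rule ext)
      fix s
      show "(s + (- t) \<le> 0 \<longrightarrow> ennreal (h (s + (- t))) \<le> z) \<longleftrightarrow>
            (s \<in> {0..t} \<longrightarrow> ennreal (k s) \<le> z)"
        \<comment> \<open>For \<open>s < 0\<close> the left side reads \<open>0 \<le> z\<close>,
          which holds for every \<open>z\<close> in \<open>ennreal\<close>, and the right side is
          vacuous. For \<open>s > t\<close> both sides are vacuous.\<close>
        using eq[of s] zero[of "s - t"] by (cases "0 \<le> s") auto
    qed
    also have "\<dots> \<longleftrightarrow> (AE s in lebesgue_on {0..t}. ennreal (k s) \<le> z)"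
      by (subst AE_restrict_space_iff) auto
    finally show ?thesis .
  qed
  then show ?thesis
    unfolding ess_sup_on_def using h k by (intro arg_cong[where f = enn2real] esssup_eqI) auto
qed

lemma borel_measurable_weighted_dist:
  fixes va vb :: "real \<Rightarrow> 'a::euclidean_space"
  assumes "continuous_on A \<omega>" "A \<in> sets lebesgue" "va \<in> L_inf UNIV" "vb \<in> L_inf UNIV"
  shows "(\<lambda>s. \<omega> s * norm (va s - vb s) :: real) \<in> borel_measurable (lebesgue_on A)"
proof -
  have "va \<in> borel_measurable (lebesgue_on A)" "vb \<in> borel_measurable (lebesgue_on A)"
    using assms(3,4) by (auto simp: L_inf_def intro: measurable_restrict_space1)
  moreover have "\<omega> \<in> borel_measurable (lebesgue_on A)"
    using assms(1,2) by (rule continuous_imp_measurable_on_sets_lebesgue)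
  ultimately show ?thesis by measurable
qed

text \<open>Time invariance moves the observation time from \<open>0\<close> to \<open>t\<close>:
  \<open>G (shift (- t) v) 0 = shift (- t) (G v) 0 = G v t\<close>.\<close>

lemma memory_functional_shift:
  assumes "causal U G" "time_invariant U G" "v \<in> U"
  shows "memory_functional U G (neg_part (shift (- t) v)) = G v t"
proof -
  have "shift (- t) v \<in> U" "G (shift (- t) v) = shift (- t) (G v)"
    using assms(2,3) by (auto simp: time_invariant_def)
  then show ?thesis
    using memory_functional_neg_part[OF assms(1)] by (simp add: shift_def)
qed

text \<open>Substituting \<open>s - t\<close> for \<open>s\<close> turns the weight
  \<open>w (- s)\<close> into \<open>w (t - s)\<close>. For \<open>s < - t\<close> both shifted
  inputs read from the common past \<open>u0\<close>, so their difference is zero there.\<close>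

lemma ess_sup_on_shifted_concat:
  fixes ua ub :: "real \<Rightarrow> 'a::euclidean_space"
  assumes w: "continuous_on {0..} w" and "0 \<le> t"
    and L: "u0 \<diamondop> ua \<in> L_inf UNIV" "u0 \<diamondop> ub \<in> L_inf UNIV"
      "shift (- t) (u0 \<diamondop> ua) \<in> L_inf UNIV" "shift (- t) (u0 \<diamondop> ub) \<in> L_inf UNIV"
  shows "ess_sup_on {..0} (\<lambda>s. w (- s) *
           norm (shift (- t) (u0 \<diamondop> ua) s - shift (- t) (u0 \<diamondop> ub) s)) =
         ess_sup_on {0..t} (\<lambda>s. w (t - s) * norm (ua s - ub s))"
proof (rule ess_sup_on_past_eq)
  have "continuous_on {..0} (\<lambda>s. w (- s))"
    by (rule continuous_on_compose2[OF w]) (auto intro!: continuous_intros)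
  then show "(\<lambda>s. w (- s) * norm (shift (- t) (u0 \<diamondop> ua) s - shift (- t) (u0 \<diamondop> ub) s))
      \<in> borel_measurable (lebesgue_on {..0})"
    using L by (intro borel_measurable_weighted_dist) auto
  have "continuous_on {0..t} (\<lambda>s. w (t - s))"
    by (rule continuous_on_compose2[OF w]) (auto intro!: continuous_intros)
  \<comment> \<open>Measurability is given for the concatenations, not for \<open>ua\<close> and
    \<open>ub\<close>. It transfers because they coincide at every point of \<open>{0..t}\<close>,
    including \<open>0\<close>, where the concatenation takes its second argument.\<close>
  then have "(\<lambda>s. w (t - s) * norm ((u0 \<diamondop> ua) s - (u0 \<diamondop> ub) s))
      \<in> borel_measurable (lebesgue_on {0..t})"
    using L by (intro borel_measurable_weighted_dist) auto
  then show "(\<lambda>s. w (t - s) * norm (ua s - ub s)) \<in> borel_measurable (lebesgue_on {0..t})"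
    by (rule measurable_cong[THEN iffD1, rotated]) (auto simp: concat_at_0_def)
qed (use \<open>0 \<le> t\<close> in \<open>auto simp: shift_def concat_at_0_def\<close>)

lemma class_KL_times_exp: "class_KL (\<lambda>r s. r * exp (- s))"
proof -
  have "((\<lambda>s. r * exp (- s)) \<longlongrightarrow> 0) at_top" for r :: real
    by (intro tendsto_mult_right_zero filterlim_compose[OF exp_at_bot filterlim_uminus_at_bot_at_top])
  then show ?thesis
    unfolding class_KL_def class_K_def
    by (auto simp: case_prod_unfold strict_mono_on_def monotone_on_def
        intro!: continuous_intros mult_left_mono)
qed

theorem theorem1:
  fixes w :: "real \<Rightarrow> real"
    and f :: "real ^ 'nx \<Rightarrow> real ^ 'nu \<Rightarrow> real ^ 'nx"
    and g :: "real ^ 'nx \<Rightarrow> real ^ 'nu \<Rightarrow> real ^ 'ny"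
    and U :: "(real \<Rightarrow> real ^ 'nu) set"
    and Y :: "(real \<Rightarrow> real ^ 'ny) set"
    and G :: "(real \<Rightarrow> real ^ 'nu) \<Rightarrow> real \<Rightarrow> real ^ 'ny"
    and x0 :: "real ^ 'nx"
    and u0 :: "real \<Rightarrow> real ^ 'nu"
  assumes "memory_kernel w"
    and "U \<subseteq> L_inf UNIV"
    and "Y \<subseteq> L_inf UNIV"
    and "smooth (\<lambda>(x, u). g x u)"
    and "forward_complete f {x0} (pos_part ` U)"
    and "realization f g U Y x0 u0 G"
  shows "uniform_FM w U G {shifted_inputs U u0 t | t. t \<ge> 0} \<longleftrightarrow>
         state_space_FM w f g (pos_part ` U) {x0}"
proof -
  let ?Up = "pos_part ` U"
  let ?d = "\<lambda>t ua ub. ess_sup_on {0..t} (\<lambda>s. w (t - s) * norm (ua s - ub s))"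
  have w: "continuous_on {0..} w"
    using assms(1) by (simp add: memory_kernel_def)
  have causal: "causal U G" and inv: "time_invariant U G"
    and concat: "\<And>u. u \<in> ?Up \<Longrightarrow> u0 \<diamondop> u \<in> U"
    and out: "\<And>u x t. u \<in> ?Up \<Longrightarrow> state_trajectory f x0 u x \<Longrightarrow> 0 \<le> t \<Longrightarrow>
                g (x t) (u t) = G (u0 \<diamondop> u) t"
    using assms(6) unfolding realization_def by blast+
  \<comment> \<open>The state-space bound speaks only about given trajectories; deriving a bound on
    \<open>G\<close> from it requires that every input has one.\<close>
  have traj: "\<exists>x. state_trajectory f x0 u x" if "u \<in> ?Up" for u
    using assms(5) that unfolding forward_complete_def by blast
  have F: "memory_functional U G (neg_part (shift (- t) (u0 \<diamondop> u))) = G (u0 \<diamondop> u) t"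
    if "u \<in> ?Up" for u t
    using memory_functional_shift[OF causal inv concat[OF that]] .
  have shift: "shift (- t) (u0 \<diamondop> u) \<in> U" if "u \<in> ?Up" for u t
    using inv concat[OF that] by (simp add: time_invariant_def)
  have dist: "ess_sup_on {..0} (\<lambda>s. w (- s) *
      norm (shift (- t) (u0 \<diamondop> ua) s - shift (- t) (u0 \<diamondop> ub) s)) = ?d t ua ub"
    if "ua \<in> ?Up" "ub \<in> ?Up" "0 \<le> t" for ua ub t
    by (intro ess_sup_on_shifted_concat w subsetD[OF assms(2)] concat shift that)
  \<comment> \<open>With the gain \<gamma> unchanged, fading memory of \<open>G\<close> becomes a
    bound on \<open>G (u0 \<diamondop> u) t\<close>. In this form it differs from the state-space
    property only by the \<beta> term and by writing outputs through \<open>G\<close>.\<close>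
  have lhs: "uniform_FM w U G {shifted_inputs U u0 t | t. t \<ge> 0} \<longleftrightarrow>
      (\<exists>\<gamma>. class_K_inf \<gamma> \<and> (\<forall>ua\<in>?Up. \<forall>ub\<in>?Up. \<forall>t\<ge>0.
        norm (G (u0 \<diamondop> ua) t - G (u0 \<diamondop> ub) t) \<le> \<gamma> (?d t ua ub)))"
    unfolding uniform_FM_def
  proof (intro ex_cong1 conj_cong refl iffI ballI allI impI)
    fix \<gamma> ua ub and t :: real
    assume bound: "\<forall>S\<in>{shifted_inputs U u0 t | t. t \<ge> 0}. \<forall>va\<in>S. \<forall>vb\<in>S.
        norm (memory_functional U G (neg_part va) - memory_functional U G (neg_part vb))
          \<le> \<gamma> (ess_sup_on {..0} (\<lambda>s. w (- s) * norm (va s - vb s)))"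
      and u: "ua \<in> ?Up" "ub \<in> ?Up" and t: "0 \<le> t"
    have mem: "shift (- t) (u0 \<diamondop> ua) \<in> shifted_inputs U u0 t"
      "shift (- t) (u0 \<diamondop> ub) \<in> shifted_inputs U u0 t"
      using u by (auto simp: shifted_inputs_def)
    have "norm (memory_functional U G (neg_part (shift (- t) (u0 \<diamondop> ua)))
          - memory_functional U G (neg_part (shift (- t) (u0 \<diamondop> ub))))
        \<le> \<gamma> (ess_sup_on {..0} (\<lambda>s. w (- s) *
              norm (shift (- t) (u0 \<diamondop> ua) s - shift (- t) (u0 \<diamondop> ub) s)))"
      by (rule bspec[OF bspec[OF bspec[OF bound] mem(1)] mem(2)]) (use t in blast)
    then show "norm (G (u0 \<diamondop> ua) t - G (u0 \<diamondop> ub) t) \<le> \<gamma> (?d t ua ub)"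
      by (simp only: F[OF u(1)] F[OF u(2)] dist[OF u t])
  next
    fix \<gamma> S va vb
    assume bound: "\<forall>ua\<in>?Up. \<forall>ub\<in>?Up. \<forall>t\<ge>0.
        norm (G (u0 \<diamondop> ua) t - G (u0 \<diamondop> ub) t) \<le> \<gamma> (?d t ua ub)"
      and "S \<in> {shifted_inputs U u0 t | t. t \<ge> 0}" "va \<in> S" "vb \<in> S"
    \<comment> \<open>Both inputs come from the same member \<open>S\<close> of the family, hence
      share one shift \<open>t\<close>; \<open>dist\<close> applies only to such pairs.\<close>
    then obtain t ua ub where t: "0 \<le> t" and u: "ua \<in> ?Up" "ub \<in> ?Up"
      and v: "va = shift (- t) (u0 \<diamondop> ua)" "vb = shift (- t) (u0 \<diamondop> ub)"
      unfolding shifted_inputs_def by blast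
    show "norm (memory_functional U G (neg_part va) - memory_functional U G (neg_part vb))
          \<le> \<gamma> (ess_sup_on {..0} (\<lambda>s. w (- s) * norm (va s - vb s)))"
      unfolding v F[OF u(1)] F[OF u(2)] dist[OF u t] using bound u t by blast
  qed
  have zero: "\<beta> 0 t = 0" if "class_KL \<beta>" "0 \<le> t" for \<beta> t
    using that by (auto simp: class_KL_def class_K_def)
  show ?thesis
    unfolding lhs
  proof
    assume "\<exists>\<gamma>. class_K_inf \<gamma> \<and> (\<forall>ua\<in>?Up. \<forall>ub\<in>?Up. \<forall>t\<ge>0.
        norm (G (u0 \<diamondop> ua) t - G (u0 \<diamondop> ub) t) \<le> \<gamma> (?d t ua ub))"
    then obtain \<gamma> where "class_K_inf \<gamma>" and bound: "\<forall>ua\<in>?Up. \<forall>ub\<in>?Up. \<forall>t\<ge>0.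
        norm (G (u0 \<diamondop> ua) t - G (u0 \<diamondop> ub) t) \<le> \<gamma> (?d t ua ub)"
      by blast
    have FM: "norm (g (xa t) (ua t) - g (xb t) (ub t)) \<le> \<gamma> (?d t ua ub)"
      if "ua \<in> ?Up" "ub \<in> ?Up" "state_trajectory f x0 ua xa" "state_trajectory f x0 ub xb" "0 \<le> t"
      for ua ub xa xb t
      unfolding out[OF that(1,3,5)] out[OF that(2,4,5)]
      using bound that(1,2,5) by blast
    show "state_space_FM w f g ?Up {x0}"
      unfolding state_space_FM_def
    proof (intro exI conjI ballI allI impI)
      show "class_KL (\<lambda>r s. r * exp (- s))"
        by (rule class_KL_times_exp)
      show "class_K_inf \<gamma>"
        by fact
      fix xa0 xb0 ua ub xa xb and t :: real
      assume "xa0 \<in> {x0}" "xb0 \<in> {x0}" and u: "ua \<in> ?Up" "ub \<in> ?Up"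
        and x: "state_trajectory f xa0 ua xa" "state_trajectory f xb0 ub xb" and t: "0 \<le> t"
      then have "xa0 = x0" "xb0 = x0"
        by simp_all
      with FM[OF u _ _ t] x
      show "norm (g (xa t) (ua t) - g (xb t) (ub t)) \<le>
          norm (xa0 - xb0) * exp (- t) + \<gamma> (?d t ua ub)"
        by simp
    qed
  next
    assume "state_space_FM w f g ?Up {x0}"
    then obtain \<beta> \<gamma> where "class_KL \<beta>" "class_K_inf \<gamma>"
      and bound: "\<And>ua ub xa xb t. ua \<in> ?Up \<Longrightarrow> ub \<in> ?Up \<Longrightarrow> state_trajectory f x0 ua xa \<Longrightarrow>
        state_trajectory f x0 ub xb \<Longrightarrow> 0 \<le> t \<Longrightarrow>
        norm (g (xa t) (ua t) - g (xb t) (ub t)) \<le> \<beta> (norm (x0 - x0)) t + \<gamma> (?d t ua ub)"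
      unfolding state_space_FM_def by blast
    moreover have "norm (G (u0 \<diamondop> ua) t - G (u0 \<diamondop> ub) t) \<le> \<gamma> (?d t ua ub)"
      if u: "ua \<in> ?Up" "ub \<in> ?Up" and t: "0 \<le> t" for ua ub t
    proof -
      obtain xa xb where x: "state_trajectory f x0 ua xa" "state_trajectory f x0 ub xb"
        using traj u by blast
      show ?thesis
        \<comment> \<open>The initial states coincide, so \<beta> is evaluated at
          \<open>norm (x0 - x0) = 0\<close> and drops out; \<open>out\<close> then replaces the
          outputs by values of \<open>G\<close>.\<close>
        using bound[OF u x t] zero[OF \<open>class_KL \<beta>\<close> t]
        by (simp add: out[OF u(1) x(1) t] out[OF u(2) x(2) t])
    qed
    ultimately show "\<exists>\<gamma>. class_K_inf \<gamma> \<and> (\<forall>ua\<in>?Up. \<forall>ub\<in>?Up. \<forall>t\<ge>0.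
        norm (G (u0 \<diamondop> ua) t - G (u0 \<diamondop> ub) t) \<le> \<gamma> (?d t ua ub))"
      by blast
  qed
qed

end
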